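(* The bifurcation diagram $\mathcal{B}_{\mathrm{top}}$ controlling the topology of $\overline{\Sigma}_{C,h}$ and the bifurcation diagram $\mathcal{B}_{\mathrm{eq}}$ of relative equilibria coincide as subsets of the $(C,h)$-plane: $\mathcal{B}_{\mathrm{top}}=\mathcal{B}_{\mathrm{eq}}$.
   Context: On $\mathbb{R}^5$ with coordinates $(\xi,p,m_1,m_2,m_3)$, $\xi=\cot q$ with $q\in(0,\pi)$, consider $$\mathcal{H}=\tfrac12\left(m_1^2+m_2^2-2m_1p+2p^2+\xi(-2-2m_2m_3+m_3^2\xi)+m_3^2(1+\xi^2)\right),\qquad \mathcal{C}=m_1^2+m_2^2+m_3^2$$ (the reduced Hamiltonian and the Casimir of the equal-mass two-body problem on $S^2$ with cotangent potential); $\overline{\Sigma}_{C,h}$ is the compactification of $\{\mathcal{H}=h,\ \mathcal{C}=C\}$. Topological diagram. The number of holes in the image of the projection of $\overline{\Sigma}_{C,h}$ to the sphere $\{m_1^2+m_2^2+m_3^2=C\}$ is governed by the roots of the following polynomial in $y=m_3^2$: $$P_{C,h}(y)=\tfrac14y^4+\left(\tfrac C2-2h\right)y^3+\left(\tfrac{C^2}{4}-2Ch+4h^2+\tfrac12\right)y^2+\left(2h-\tfrac{3C}{2}\right)y+\tfrac14 .$$ The diagram $\mathcal{B}_{\mathrm{top}}$ is the set of pairs $(C,h)$ for which $P_{C,h}$ has a positive real root of multiplicity greater than one. Explicitly, it is the union of the locus $$\tfrac1{54}S^3+\tfrac16(C-4h)S^2+\tfrac13\left((C-4h)^2+2\right)S-6C+8h=0,\qquad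 S=\sqrt{(C-4h)^2+12}-C+4h,$$ and the part of the line $h=\frac C2$ on which $4h-C>0$ and $(C-4h)^2\ge 4$. Relative-equilibria diagram. The relative equilibria (equilibria of the reduced system) form two families: (i) $m_1=p=0$, $m_3=\pm\sqrt{\tan(q/2)}$, $m_2=\mp\tan(q/2)^{3/2}$, with $q\in(0,\pi)$; (ii) $q=\frac\pi2$, $m_1=p=0$, $m_2=-\frac1{m_3}$, with $m_3\neq0$. The diagram $\mathcal{B}_{\mathrm{eq}}$ is the set of values $(\mathcal{C},\mathcal{H})$ on these families, i.e. the union of the two parametrised curves $$C(q)=\tan^3\tfrac q2+\tan\tfrac q2,\quad h(q)=\tfrac12\left(\tan^3\tfrac q2+\tan\tfrac q2\right)+\cot q\left(\tan^2\tfrac q2+\tan\tfrac q2\cot q-1\right),\quad q\in(0,\pi),$$ $$C(m_3)=m_3^2+\tfrac1{m_3^2},\quad h(m_3)=\tfrac12\left(m_3^2+\tfrac1{m_3^2}\right),\quad m_3\neq0.$$ *)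

theory Defs
  imports Complex_Main "HOL-Computational_Algebra.Polynomial"
begin

text \<open>Points of the reduced phase space are tuples \<open>(\<xi>, p, m1, m2, m3)\<close> with \<open>\<xi> = cot q\<close>.\<close>

type_synonym state = "real \<times> real \<times> real \<times> real \<times> real"

definition Ham :: "state \<Rightarrow> real" where
  "Ham = (\<lambda>(\<xi>, p, m1, m2, m3).
     1/2 * (m1\<^sup>2 + m2\<^sup>2 - 2 * m1 * p + 2 * p\<^sup>2
            + \<xi> * (- 2 - 2 * m2 * m3 + m3\<^sup>2 * \<xi>) + m3\<^sup>2 * (1 + \<xi>\<^sup>2)))"

definition Casimir :: "state \<Rightarrow> real" where
  "Casimir = (\<lambda>(\<xi>, p, m1, m2, m3). m1\<^sup>2 + m2\<^sup>2 + m3\<^sup>2)"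

text \<open>The polynomial in \<open>y = m3\<^sup>2\<close>; coefficients are listed from degree 0 to degree 4.\<close>

definition P :: "real \<Rightarrow> real \<Rightarrow> real poly" where
  "P C h = [: 1/4,
              2 * h - 3 * C / 2,
              C\<^sup>2 / 4 - 2 * C * h + 4 * h\<^sup>2 + 1/2,
              C / 2 - 2 * h,
              1/4 :]"

definition B_top :: "(real \<times> real) set" where
  "B_top = {(C, h). \<exists>y > 0. order y (P C h) > 1}"

text \<open>In the first family \<open>\<sigma>\<close> is the choice of sign: the signs of \<open>m2\<close> and \<open>m3\<close> are opposite.\<close>

definition rel_eq_1 :: "state set" where
  "rel_eq_1 = {(cot q, 0, 0, - \<sigma> * tan (q/2) powr (3/2), \<sigma> * sqrt (tan (q/2))) | q \<sigma>.
                 0 < q \<and> q < pi \<and> \<sigma> \<in> {1, - 1}}"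

definition rel_eq_2 :: "state set" where
  "rel_eq_2 = {(cot (pi/2), 0, 0, - 1 / m3, m3) | m3. m3 \<noteq> 0}"

definition B_eq :: "(real \<times> real) set" where
  "B_eq = (\<lambda>z. (Casimir z, Ham z)) ` (rel_eq_1 \<union> rel_eq_2)"

end

theory Submission
  imports Defs
begin

text \<open>Write \<open>a = C - 4h\<close>, \<open>b = 2C - 4h\<close> and \<open>Q = y\<^sup>2 + ay + 1\<close>. Then \<open>P\<close> takes the value
  \<open>Q\<^sup>2/4 - by\<close> at \<open>y\<close>, so \<open>y > 0\<close> is a multiple root iff \<open>Q\<^sup>2/4 = by\<close> and \<open>Q(2y + a)/2 = b\<close>.
  Eliminating \<open>b\<close> leaves two cases. If \<open>Q = 0\<close>, then \<open>b = 0\<close>, which is the second family of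
  relative equilibria with \<open>y = m3\<^sup>2\<close>; if \<open>Q = 2y(2y + a)\<close>, then \<open>ay = 1 - 3y\<^sup>2\<close>, which is the
  first family with \<open>y = tan (q/2)\<close>.\<close>

text \<open>In characteristic 0 differentiation lowers the order of a root by exactly one if the
  derivative is nonzero. A vanishing derivative leaves a nonzero constant, which has no
  roots.\<close>

lemma order_gt_1_iff:
  fixes p :: "'a::field_char_0 poly"
  assumes "p \<noteq> 0"
  shows "order y p > 1 \<longleftrightarrow> poly p y = 0 \<and> poly (pderiv p) y = 0"
proof (cases "pderiv p = 0")
  case True
  then obtain c where "p = [:c:]"
    by (metis degree_eq_zeroE pderiv_eq_0_iff)
  with assms have "poly p y \<noteq> 0" by auto
  then show ?thesis
    by (simp add: order_0I)
next
  case False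
  show ?thesis
  proof (cases "poly p y = 0")
    case True
    then have "order y p = Suc (order y (pderiv p))"
      using assms False by (intro order_pderiv) (auto simp: order_root)
    then show ?thesis
      using True False by (simp add: order_root)
  qed (simp add: order_0I)
qed

lemma P_multiple_root_iff:
  "order y (P C h) > 1 \<longleftrightarrow>
     (y\<^sup>2 + (C - 4 * h) * y + 1)\<^sup>2 / 4 = (2 * C - 4 * h) * y \<and>
     (y\<^sup>2 + (C - 4 * h) * y + 1) * (2 * y + (C - 4 * h)) / 2 = 2 * C - 4 * h"
proof -
  have nz: "P C h \<noteq> 0"
    by (simp add: P_def)
  moreover have "poly (P C h) y =
      (y\<^sup>2 + (C - 4 * h) * y + 1)\<^sup>2 / 4 - (2 * C - 4 * h) * y"
    by (simp add: P_def field_simps power2_eq_square)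
  moreover have "poly (pderiv (P C h)) y =
      (y\<^sup>2 + (C - 4 * h) * y + 1) * (2 * y + (C - 4 * h)) / 2 - (2 * C - 4 * h)"
    by (simp add: P_def pderiv_pCons field_simps power2_eq_square)
  ultimately show ?thesis
    unfolding order_gt_1_iff[OF nz] by simp
qed

lemma P_multiple_root_cases:
  assumes "y > 0"
  shows "order y (P C h) > 1 \<longleftrightarrow>
     (C = y ^ 3 + y \<and> h = (y ^ 4 + 4 * y\<^sup>2 - 1) / (4 * y)) \<or> (C = y + 1 / y \<and> h = C / 2)"
    (is "_ \<longleftrightarrow> ?first \<or> ?second")
proof
  define a b Q where "a = C - 4 * h" and "b = 2 * C - 4 * h" and "Q = y\<^sup>2 + a * y + 1"
  assume "order y (P C h) > 1"
  then have root: "Q\<^sup>2 / 4 = b * y" and deriv: "Q * (2 * y + a) / 2 = b"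
    unfolding P_multiple_root_iff a_def b_def Q_def by simp_all
  \<comment> \<open>Insert \<open>b = Q * (2 * y + a) / 2\<close> into \<open>root\<close> and clear
    the denominator 4.\<close>
  have "Q * (Q - 2 * y * (2 * y + a)) = 0"
    using root unfolding deriv[symmetric] by (simp add: field_simps power2_eq_square)
  then consider "Q = 0" | "Q = 2 * y * (2 * y + a)"
    by auto
  then show "?first \<or> ?second"
  proof cases
    case 1
    then have "b = 0" using deriv by simp
    then have h: "h = C / 2" by (simp add: b_def)
    with 1 have "C * y = y * y + 1"
      by (simp add: Q_def a_def power2_eq_square algebra_simps)
    with h show ?thesis
      using assms by (simp add: field_simps)
  next
    case 2
    then have ay: "a * y = 1 - 3 * y\<^sup>2"
      by (simp add: Q_def power2_eq_square algebra_simps)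
    have b: "b = y * (2 * y + a)\<^sup>2"
      using deriv 2 by (simp add: power2_eq_square algebra_simps)
    have "b * y = (2 * y * y + a * y)\<^sup>2"
      unfolding b by (simp add: power2_eq_square algebra_simps)
    also have "\<dots> = (1 - y\<^sup>2)\<^sup>2"
      unfolding ay by (simp add: power2_eq_square)
    \<comment> \<open>Since \<open>b - a = C\<close>, subtracting \<open>ay\<close> from the
      equation for \<open>b * y\<close> isolates \<open>C\<close>; then \<open>y > 0\<close>
      cancels.\<close>
    finally have "(b - a) * y = (y ^ 3 + y) * y"
      using ay by (simp add: algebra_simps power2_eq_square power3_eq_cube)
    then have C: "C = y ^ 3 + y"
      using assms by (simp add: a_def b_def)
    have "4 * h * y = C * y - a * y"
      by (simp add: a_def algebra_simps)
    then have "4 * h * y = y ^ 4 + 4 * y\<^sup>2 - 1"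
      unfolding ay C by (simp add: algebra_simps power2_eq_square power3_eq_cube power4_eq_xxxx)
    then have ?first
      using assms C by (simp add: field_simps)
    then show ?thesis ..
  qed
next
  assume "?first \<or> ?second"
  then show "order y (P C h) > 1"
  proof
    assume first: ?first
    \<comment> \<open>With these values both conditions for a multiple root become identities
      between multiples of (1 - y^2)^2.\<close>
    have a: "C - 4 * h = (1 - 3 * y\<^sup>2) / y" and b: "2 * C - 4 * h = (1 - y\<^sup>2)\<^sup>2 / y"
      using first assms by (simp_all add: field_simps power2_eq_square power3_eq_cube power4_eq_xxxx)
    have Q: "y\<^sup>2 + (C - 4 * h) * y + 1 = 2 * (1 - y\<^sup>2)"
      unfolding a using assms by simp
    have Q': "2 * y + (C - 4 * h) = (1 - y\<^sup>2) / y"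
      unfolding a using assms by (simp add: field_simps power2_eq_square)
    show ?thesis
      unfolding P_multiple_root_iff b Q Q' using assms by (simp add: field_simps power2_eq_square)
  next
    assume second: ?second
    have "C - 4 * h = - (y + 1 / y)"
      using second by simp
    then have Q: "y\<^sup>2 + (C - 4 * h) * y + 1 = 0"
      using assms by (simp add: field_simps power2_eq_square)
    have b: "2 * C - 4 * h = 0"
      using second by simp
    show ?thesis
      unfolding P_multiple_root_iff Q b by simp
  qed
qed

text \<open>Makes cot q rational in tan (q/2), so that the energy along the first family becomes a
  rational function of that parameter.\<close>

lemma cot_half_angle:
  fixes q :: real
  assumes "0 < q" "q < pi"
  shows "cot q = (1 - (tan (q/2))\<^sup>2) / (2 * tan (q/2))"
proof -
  have s: "sin (q/2) > 0" and c: "cos (q/2) > 0"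
    using assms by (auto intro: sin_gt_zero cos_gt_zero)
  have "cot q = cos (2 * (q/2)) / sin (2 * (q/2))"
    by (simp add: cot_def)
  also have "\<dots> = ((cos (q/2))\<^sup>2 - (sin (q/2))\<^sup>2) / (2 * sin (q/2) * cos (q/2))"
    by (simp only: cos_double sin_double)
  also have "\<dots> = (1 - (tan (q/2))\<^sup>2) / (2 * tan (q/2))"
    using s c by (simp add: tan_def field_simps power2_eq_square)
  finally show ?thesis .
qed

text \<open>Both functions involve \<open>m2\<close> and \<open>m3\<close> only through their
  squares and their product. There \<sigma> occurs squared and the square roots pair up, so the
  values are rational in \<open>t\<close> and the same for both signs.\<close>

lemma Casimir_Ham_rel_eq_1:
  assumes "0 < q" "q < pi" "\<sigma> \<in> {1, - 1}" and t: "t = tan (q/2)"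
  defines "z \<equiv> (cot q, 0, 0, - \<sigma> * tan (q/2) powr (3/2), \<sigma> * sqrt (tan (q/2)))"
  shows "Casimir z = t ^ 3 + t" "Ham z = (t ^ 4 + 4 * t\<^sup>2 - 1) / (4 * t)"
proof -
  have pos: "t > 0"
    unfolding t using assms by (intro tan_gt_zero) auto
  have powr: "t powr (3/2) = t * sqrt t"
    using pos powr_add[of t 1 "1/2"] by (simp add: powr_half_sqrt)
  have \<sigma>: "\<sigma> * \<sigma> = 1"
    using assms by auto
  define m2 m3 where "m2 = - \<sigma> * (t * sqrt t)" and "m3 = \<sigma> * sqrt t"
  have z: "z = ((1 - t\<^sup>2) / (2 * t), 0, 0, m2, m3)"
    unfolding z_def m2_def m3_def cot_half_angle[OF assms(1,2)] t[symmetric] powr ..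
  have "m2\<^sup>2 = (\<sigma> * \<sigma>) * t\<^sup>2 * (sqrt t)\<^sup>2"
    unfolding m2_def by (simp add: power2_eq_square algebra_simps)
  then have m2: "m2\<^sup>2 = t ^ 3"
    using pos \<sigma> by (simp add: power2_eq_square power3_eq_cube)
  have "m3\<^sup>2 = (\<sigma> * \<sigma>) * (sqrt t)\<^sup>2"
    unfolding m3_def by (simp add: power2_eq_square algebra_simps)
  then have m3: "m3\<^sup>2 = t"
    using pos \<sigma> by simp
  have "m2 * m3 = - (\<sigma> * \<sigma>) * t * (sqrt t)\<^sup>2"
    unfolding m2_def m3_def by (simp add: power2_eq_square algebra_simps)
  then have m23: "2 * m2 * m3 = - 2 * t\<^sup>2"
    using pos \<sigma> by (simp add: power2_eq_square)
  show "Casimir z = t ^ 3 + t"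
    by (simp add: z Casimir_def m2 m3)
  show "Ham z = (t ^ 4 + 4 * t\<^sup>2 - 1) / (4 * t)"
    unfolding z Ham_def prod.case m2 m3 m23
    using pos by (simp add: field_simps power2_eq_square power3_eq_cube power4_eq_xxxx)
qed

text \<open>The map from q to tan (q/2) sends the interval (0, pi) onto the positive reals, so y =
  tan (q/2) replaces the angle as parameter.\<close>

lemma rel_eq_1_image:
  "(\<lambda>z. (Casimir z, Ham z)) ` rel_eq_1 =
     {(y ^ 3 + y, (y ^ 4 + 4 * y\<^sup>2 - 1) / (4 * y)) | y. y > 0}"
proof (intro equalityI subsetI)
  fix x assume "x \<in> (\<lambda>z. (Casimir z, Ham z)) ` rel_eq_1"
  then obtain q \<sigma> where "0 < q" "q < pi" "\<sigma> \<in> {1, - 1}"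
    and "x = (\<lambda>z. (Casimir z, Ham z))
               (cot q, 0, 0, - \<sigma> * tan (q/2) powr (3/2), \<sigma> * sqrt (tan (q/2)))"
    unfolding rel_eq_1_def by blast
  moreover from this have "tan (q/2) > 0"
    by (intro tan_gt_zero) auto
  ultimately show "x \<in> {(y ^ 3 + y, (y ^ 4 + 4 * y\<^sup>2 - 1) / (4 * y)) | y. y > 0}"
    using Casimir_Ham_rel_eq_1[of q \<sigma>] by blast
next
  fix x :: "real \<times> real"
  assume "x \<in> {(y ^ 3 + y, (y ^ 4 + 4 * y\<^sup>2 - 1) / (4 * y)) | y. y > 0}"
  then obtain y where y: "y > 0" "x = (y ^ 3 + y, (y ^ 4 + 4 * y\<^sup>2 - 1) / (4 * y))"
    by blast
  define q where "q = 2 * arctan y"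
  have q: "0 < q" "q < pi" "y = tan (q/2)"
    using y arctan_ubound[of y] by (auto simp: q_def tan_arctan)
  \<comment> \<open>Either sign gives the same values; \<sigma> = 1 is taken, with its factors
    written out to match the form of \<open>rel_eq_1\<close>.\<close>
  define z where "z = (cot q, 0::real, 0::real, - 1 * tan (q/2) powr (3/2), 1 * sqrt (tan (q/2)))"
  have "z \<in> rel_eq_1"
    unfolding rel_eq_1_def z_def using q by blast
  moreover have "x = (Casimir z, Ham z)"
    using Casimir_Ham_rel_eq_1[of q 1 y] q y by (simp add: z_def)
  ultimately show "x \<in> (\<lambda>z. (Casimir z, Ham z)) ` rel_eq_1"
    by blast
qed

text \<open>At q = pi/2 the cotangent vanishes, so the energy is half the Casimir. Only the square
  of \<open>m3\<close> enters, and y = \<open>m3\<close>^2 covers all positive reals.\<close>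

lemma rel_eq_2_image:
  "(\<lambda>z. (Casimir z, Ham z)) ` rel_eq_2 = {(y + 1 / y, (y + 1 / y) / 2) | y. y > 0}"
proof -
  have eq: "(Casimir (cot (pi/2), 0, 0, - 1 / m, m), Ham (cot (pi/2), 0, 0, - 1 / m, m)) =
      (m\<^sup>2 + 1 / m\<^sup>2, (m\<^sup>2 + 1 / m\<^sup>2) / 2)" for m :: real
    by (simp add: Casimir_def Ham_def cot_def power_divide)
  show ?thesis
  proof (intro equalityI subsetI)
    fix x assume "x \<in> (\<lambda>z. (Casimir z, Ham z)) ` rel_eq_2"
    then obtain m :: real where "m \<noteq> 0" "x = (m\<^sup>2 + 1 / m\<^sup>2, (m\<^sup>2 + 1 / m\<^sup>2) / 2)"
      unfolding rel_eq_2_def using eq by blast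
    moreover from this have "m\<^sup>2 > 0"
      by simp
    ultimately show "x \<in> {(y + 1 / y, (y + 1 / y) / 2) | y. y > 0}"
      by blast
  next
    fix x :: "real \<times> real"
    assume "x \<in> {(y + 1 / y, (y + 1 / y) / 2) | y. y > 0}"
    then obtain y where "y > 0" "x = (y + 1 / y, (y + 1 / y) / 2)"
      by blast
    then have "sqrt y \<noteq> 0" "x = (\<lambda>z. (Casimir z, Ham z)) (cot (pi/2), 0, 0, - 1 / sqrt y, sqrt y)"
      using eq[of "sqrt y"] by auto
    then show "x \<in> (\<lambda>z. (Casimir z, Ham z)) ` rel_eq_2"
      unfolding rel_eq_2_def by blast
  qed
qed

theorem proposition3p7: "B_top = B_eq"
proof -
  \<comment> \<open>The multiple root y itself serves as the parameter of both curves, matching the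
    parameters chosen for the two families of equilibria.\<close>
  have "B_top = {(y ^ 3 + y, (y ^ 4 + 4 * y\<^sup>2 - 1) / (4 * y)) | y. y > 0} \<union>
      {(y + 1 / y, (y + 1 / y) / 2) | y. y > 0}"
    unfolding B_top_def using P_multiple_root_cases by auto
  then show ?thesis
    unfolding B_eq_def image_Un rel_eq_1_image rel_eq_2_image .
qed

end
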